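(* For all nonnegative integers $n$ and all complex numbers $z$, $$\sum_{k=1}^{n} 2^{2k-1}\binom{2n}{2k-1}B_{2k-1}(z)=\sum_{k=1}^{n} k\,2^{2k}\binom{2n}{2k}E_{2k-1}(z)$$ and $$\sum_{k=0}^{n} 2^{2k}\binom{2n+1}{2k}B_{2k}(z)=\sum_{k=0}^{n}(2k+1)\,2^{2k}\binom{2n+1}{2k+1}E_{2k}(z).$$
   Context: The Bernoulli polynomials $B_n(z)$ and Euler polynomials $E_n(z)$ ($n=0,1,2,\dots$; $z\in\mathbb{C}$) are defined by $\frac{t e^{zt}}{e^t-1}=\sum_{n=0}^\infty B_n(z)\frac{t^n}{n!}$ for $|t|<2\pi$ and $\frac{2e^{zt}}{e^t+1}=\sum_{n=0}^\infty E_n(z)\frac{t^n}{n!}$ for $|t|<\pi$. Empty sums are $0$. *)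

theory Defs
  imports "HOL-Complex_Analysis.Complex_Analysis"
begin

text \<open>
  The polynomials are the coefficients, as functions of the index, in the expansions of their
  exponential generating functions. The quotient \<open>t * exp (z * t) / (exp t - 1)\<close> has a removable
  singularity at \<open>t = 0\<close> with value \<open>1\<close>, whereas HOL would give \<open>0 / 0 = 0\<close>.
  The lemmas \<open>bernoulli_poly_ex1\<close> and \<open>euler_poly_ex1\<close> show that the descriptions
  are well defined.
\<close>

definition bernoulli_gf :: "complex \<Rightarrow> complex \<Rightarrow> complex" where
  "bernoulli_gf z t = (if t = 0 then 1 else t * exp (z * t) / (exp t - 1))"

definition bernoulli_poly :: "nat \<Rightarrow> complex \<Rightarrow> complex" where
  "bernoulli_poly n z =
     (THE b. \<forall>t. norm t < 2 * pi \<longrightarrow> (\<lambda>m. b m * (t ^ m / fact m)) sums bernoulli_gf z t) n"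

definition euler_poly :: "nat \<Rightarrow> complex \<Rightarrow> complex" where
  "euler_poly n z =
     (THE e. \<forall>t. norm t < pi \<longrightarrow>
        (\<lambda>m. e m * (t ^ m / fact m)) sums (2 * exp (z * t) / (exp t + 1))) n"

lemma exp_powser_ex1:
  fixes f :: "complex \<Rightarrow> complex"
  assumes hol: "f holomorphic_on ball 0 r" and r: "r > 0"
  shows "\<exists>!b. \<forall>t. norm t < r \<longrightarrow> (\<lambda>m. b m * (t ^ m / fact m)) sums f t"
proof (rule ex_ex1I)
  show "\<exists>b. \<forall>t. norm t < r \<longrightarrow> (\<lambda>m. b m * (t ^ m / fact m)) sums f t"
  proof (intro exI allI impI)
    fix t :: complex assume "norm t < r"
    then show "(\<lambda>m. (deriv ^^ m) f 0 * (t ^ m / fact m)) sums f t"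
      using holomorphic_power_series[OF hol, of t] by simp
  qed
next
  fix a b :: "nat \<Rightarrow> complex"
  assume a: "\<forall>t. norm t < r \<longrightarrow> (\<lambda>m. a m * (t ^ m / fact m)) sums f t"
    and b: "\<forall>t. norm t < r \<longrightarrow> (\<lambda>m. b m * (t ^ m / fact m)) sums f t"
  define c where "c m = (a m - b m) / fact m" for m
  have c: "(\<lambda>m. c m * (t - 0) ^ m) sums 0" if "norm (t - 0) < r" for t
    using sums_diff[OF a[rule_format, of t] b[rule_format, of t]] that
    by (simp add: c_def diff_divide_distrib left_diff_distrib)
  have "c m = 0" for m
  proof (cases "m = 0")
    case True
    have "(\<lambda>m. c m * 0 ^ m) sums 0" using c[of 0] r by simp
    then show ?thesis using powser_sums_zero_iff[of c 0] True by simp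
  next
    case False
    show ?thesis
    proof (rule ccontr)
      assume "c m \<noteq> 0"
      then obtain s where "0 < s" and s: "\<And>z::complex. z \<in> cball 0 s - {0} \<Longrightarrow> (0::complex) \<noteq> 0"
        using powser_0_nonzero[of r "0::complex" c "\<lambda>_. 0" m] c r False by blast
      then show False using s[of "of_real s"] by simp
    qed
  qed
  then show "a = b" by (auto simp: c_def)
qed

lemma bernoulli_gf_holomorphic: "bernoulli_gf z holomorphic_on ball 0 (2 * pi)"
proof (rule no_isolated_singularity'[where K = "{0}"])
  have nz: "exp t \<noteq> 1" if "t \<in> ball 0 (2 * pi) - {0}" for t :: complex
  proof
    assume "exp t = 1"
    then obtain n :: int where n: "Re t = 0" "Im t = of_int (2 * n) * pi"
      by (auto simp: exp_eq_1)
    then have "n \<noteq> 0" using that by (auto simp: complex_eq_iff)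
    then have "1 \<le> \<bar>real_of_int n\<bar>" by linarith
    then have "2 * pi \<le> \<bar>Im t\<bar>" using n by (simp add: abs_mult)
    then show False using abs_Im_le_cmod[of t] that by simp
  qed
  have "(\<lambda>t. t * exp (z * t) / (exp t - 1)) holomorphic_on ball 0 (2 * pi) - {0}"
    by (intro holomorphic_intros) (use nz in auto)
  then show "bernoulli_gf z holomorphic_on ball 0 (2 * pi) - {0}"
    by (rule holomorphic_transform) (auto simp: bernoulli_gf_def)
next
  have "((\<lambda>t::complex. (exp t - 1) / t) \<longlongrightarrow> 1) (at 0)"
    using DERIV_exp[of "0::complex"] by (simp add: DERIV_def)
  then have "((\<lambda>t. exp (z * t) / ((exp t - 1) / t)) \<longlongrightarrow> exp (z * 0) / 1) (at 0)"
    by (intro tendsto_intros) auto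
  then have "(bernoulli_gf z \<longlongrightarrow> 1) (at 0)"
    by (simp add: bernoulli_gf_def mult.commute cong: Lim_cong_within)
  then show "(bernoulli_gf z \<longlongrightarrow> bernoulli_gf z w) (at w within ball 0 (2 * pi))" if "w \<in> {0}" for w
    using that by (auto simp: bernoulli_gf_def intro: tendsto_within_subset)
qed auto

lemma euler_gf_holomorphic:
  "(\<lambda>t. 2 * exp (z * t) / (exp t + 1)) holomorphic_on ball (0::complex) pi"
proof -
  have nz: "exp t + 1 \<noteq> 0" if "norm t < pi" for t :: complex
  proof
    assume "exp t + 1 = 0"
    then have "exp t = exp (\<i> * of_real pi)" by (simp add: eq_neg_iff_add_eq_0)
    then obtain n :: int where "t = \<i> * of_real pi + of_int (2 * n) * pi * \<i>"
      using exp_eq[of t "\<i> * of_real pi"] by auto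
    then have "Im t = (2 * of_int n + 1) * pi" by (simp add: algebra_simps)
    moreover have "1 \<le> \<bar>2 * n + 1\<bar>" by presburger
    then have "1 \<le> \<bar>2 * real_of_int n + 1\<bar>" by linarith
    ultimately have "pi \<le> \<bar>Im t\<bar>" by (simp add: abs_mult)
    then show False using abs_Im_le_cmod[of t] that by simp
  qed
  show ?thesis by (intro holomorphic_intros) (use nz in auto)
qed

lemma bernoulli_poly_ex1:
  "\<exists>!b. \<forall>t. norm t < 2 * pi \<longrightarrow> (\<lambda>m. b m * (t ^ m / fact m)) sums bernoulli_gf z t"
  by (rule exp_powser_ex1[OF bernoulli_gf_holomorphic]) simp

lemma euler_poly_ex1:
  "\<exists>!e. \<forall>t::complex. norm t < pi \<longrightarrow>
     (\<lambda>m. e m * (t ^ m / fact m)) sums (2 * exp (z * t) / (exp t + 1))"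
  by (rule exp_powser_ex1[OF euler_gf_holomorphic]) simp

lemma bernoulli_poly_sums:
  assumes "norm t < 2 * pi"
  shows "(\<lambda>n. bernoulli_poly n z * (t ^ n / fact n)) sums bernoulli_gf z t"
  using theI'[OF bernoulli_poly_ex1[of z]] assms unfolding bernoulli_poly_def by blast

lemma euler_poly_sums:
  fixes t :: complex
  assumes "norm t < pi"
  shows "(\<lambda>n. euler_poly n z * (t ^ n / fact n)) sums (2 * exp (z * t) / (exp t + 1))"
  using theI'[OF euler_poly_ex1[of z]] assms unfolding euler_poly_def by blast

end

theory Submission
  imports Defs
begin

text \<open>
  Both sides of either identity equal \<open>N * (2 * z - 1) ^ (N - 1)\<close>, where \<open>N\<close> is \<open>2 * n\<close> for the
  first and \<open>2 * n + 1\<close> for the second. Replacing \<open>t\<close> by \<open>2 * t\<close> in the generating functions gives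
  \<open>2 * t * exp (2 * z * t) / (exp (2 * t) - 1) * sinh t = t * exp ((2 * z - 1) * t)\<close> and
  \<open>2 * exp (2 * z * t) / (exp (2 * t) + 1) * cosh t = exp ((2 * z - 1) * t)\<close>.
  Since \<open>sinh\<close> is odd and \<open>cosh\<close> is even, only the terms whose index has the right parity
  contribute to a coefficient of the product. On the Euler side the factor \<open>N\<close> comes from
  \<open>(j + 1) * (N choose (j + 1)) = N * ((N - 1) choose j)\<close>.
\<close>

text \<open>Passes from convergence on a disc to formal power series, where coefficients can be
  compared. The substitution of \<open>2 * t\<close> scales the \<open>m\<close>-th coefficient by
  \<open>2 ^ m\<close> and halves the radius.\<close>

lemma egf_double_has_fps_expansion:
  fixes f :: "complex \<Rightarrow> complex"
  assumes "\<And>t. norm t < r \<Longrightarrow> (\<lambda>m. b m * (t ^ m / fact m)) sums f t" and "r > 0"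
  shows "(\<lambda>t. f (2 * t)) has_fps_expansion Abs_fps (\<lambda>m. 2 ^ m * b m / fact m)"
proof (rule has_fps_expansionI)
  have "\<forall>\<^sub>F t in nhds (0::complex). t \<in> ball 0 (r / 2)"
    using assms(2) by (intro eventually_nhds_in_open) auto
  then show "\<forall>\<^sub>F t in nhds 0.
      (\<lambda>m. fps_nth (Abs_fps (\<lambda>m. 2 ^ m * b m / fact m)) m * t ^ m) sums f (2 * t)"
  proof (eventually_elim)
    case (elim t)
    then show ?case
      using assms(1)[of "2 * t"] by (simp add: norm_mult power_mult_distrib mult_ac)
  qed
qed

lemma sinh_has_fps_expansion:
  "(sinh :: complex \<Rightarrow> complex) has_fps_expansion Abs_fps (\<lambda>m. of_bool (odd m) / fact m)"
proof (rule has_fps_expansionI, rule always_eventually, rule allI)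
  fix t :: complex
  show "(\<lambda>m. fps_nth (Abs_fps (\<lambda>m. of_bool (odd m) / fact m)) m * t ^ m) sums sinh t"
    using sinh_converges[of t]
    by (rule sums_cong[THEN iffD1, rotated]) (auto simp: scaleR_conv_of_real field_simps)
qed

lemma cosh_has_fps_expansion:
  "(cosh :: complex \<Rightarrow> complex) has_fps_expansion Abs_fps (\<lambda>m. of_bool (even m) / fact m)"
proof (rule has_fps_expansionI, rule always_eventually, rule allI)
  fix t :: complex
  show "(\<lambda>m. fps_nth (Abs_fps (\<lambda>m. of_bool (even m) / fact m)) m * t ^ m) sums cosh t"
    using cosh_converges[of t]
    by (rule sums_cong[THEN iffD1, rotated]) (auto simp: scaleR_conv_of_real field_simps)
qed

text \<open>The Cauchy product of exponential series is a binomial convolution. The 0/1 coefficients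
  of the second factor (\<open>sinh\<close> for \<open>P = odd\<close>, \<open>cosh\<close> for
  \<open>P = even\<close>) act as a filter on \<open>N - j\<close>.\<close>

lemma fps_nth_egf_mult_of_bool:
  fixes a :: "nat \<Rightarrow> 'a :: field_char_0"
  shows "fact N * fps_nth (Abs_fps (\<lambda>m. a m / fact m) * Abs_fps (\<lambda>m. of_bool (P m) / fact m)) N
           = (\<Sum>j | j \<le> N \<and> P (N - j). of_nat (N choose j) * a j)"
proof -
  have "fact N * fps_nth (Abs_fps (\<lambda>m. a m / fact m) * Abs_fps (\<lambda>m. of_bool (P m) / fact m)) N
      = (\<Sum>j=0..N. if P (N - j) then of_nat (N choose j) * a j else 0)"
    unfolding fps_mult_nth sum_distrib_left
    by (intro sum.cong) (auto simp: binomial_fact field_simps)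
  also have "\<dots> = (\<Sum>j | j \<le> N \<and> P (N - j). of_nat (N choose j) * a j)"
    by (subst sum.inter_filter [symmetric]) (auto intro: sum.cong)
  finally show ?thesis .
qed

lemma exp_double_minus_1: "exp (2 * t) - 1 = 2 * exp t * sinh (t::complex)"
  unfolding sinh_field_def exp_double exp_minus by (simp add: field_simps power2_eq_square)

lemma exp_double_plus_1: "exp (2 * t) + 1 = 2 * exp t * cosh (t::complex)"
  unfolding cosh_field_def exp_double exp_minus by (simp add: field_simps power2_eq_square)

lemma bernoulli_gf_double_mult_sinh:
  assumes "norm t < pi / 2"
  shows "bernoulli_gf z (2 * t) * sinh t = t * exp ((2 * z - 1) * t)"
proof (cases "t = 0")
  case False
  \<comment> \<open>\<open>exp\<close> is injective on the ball of radius \<open>pi\<close> about 0;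
    the bound \<open>pi / 2\<close> puts \<open>2 * t\<close> into it.\<close>
  have "exp (2 * t) \<noteq> exp 0"
    using inj_onD[OF inj_on_exp_pi[of 0], of "2 * t" 0] assms False by (auto simp: norm_mult)
  then have "sinh t \<noteq> 0" using exp_double_minus_1[of t] by auto
  moreover have "exp ((2 * z - 1) * t) = exp (z * (2 * t)) / exp t"
    by (simp add: algebra_simps flip: exp_diff)
  ultimately show ?thesis
    using False by (simp add: bernoulli_gf_def exp_double_minus_1)
qed simp

text \<open>The factor \<open>cosh t\<close> cancels. At a zero of \<open>cosh\<close> the quotient
  is a division by zero with value 0, but the right side never vanishes.\<close>

lemma euler_gf_double_mult_cosh:
  assumes "cosh t \<noteq> (0::complex)"
  shows "2 * exp (z * (2 * t)) / (exp (2 * t) + 1) * cosh t = exp ((2 * z - 1) * t)"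
proof -
  have "exp ((2 * z - 1) * t) = exp (z * (2 * t)) / exp t"
    by (simp add: algebra_simps flip: exp_diff)
  then show ?thesis using assms by (simp add: exp_double_plus_1)
qed

lemma sum_bernoulli_poly_parity:
  "(\<Sum>j | j \<le> N \<and> odd (N - j). of_nat (N choose j) * (2 ^ j * bernoulli_poly j z))
     = of_nat N * (2 * z - 1) ^ (N - 1)"
proof -
  define F where "F = Abs_fps (\<lambda>m. 2 ^ m * bernoulli_poly m z / fact m) *
    Abs_fps (\<lambda>m. of_bool (odd m) / fact m)"
  have "(\<lambda>t. bernoulli_gf z (2 * t) * sinh t) has_fps_expansion F"
    unfolding F_def
    by (intro has_fps_expansion_mult sinh_has_fps_expansion
        egf_double_has_fps_expansion[of "2 * pi"] bernoulli_poly_sums) auto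
  moreover have "\<forall>\<^sub>F t in nhds 0.
      bernoulli_gf z (2 * t) * sinh t = t * exp ((2 * z - 1) * t)"
  proof -
    have "\<forall>\<^sub>F t in nhds (0::complex). t \<in> ball 0 (pi / 2)"
      by (intro eventually_nhds_in_open) auto
    then show ?thesis
      by eventually_elim (simp add: bernoulli_gf_double_mult_sinh)
  qed
  \<comment> \<open>An expansion depends only on the germ at 0, so agreement of the functions near 0
    suffices.\<close>
  ultimately have "(\<lambda>t. t * exp ((2 * z - 1) * t)) has_fps_expansion F"
    by (rule has_fps_expansion_cong[THEN iffD1, rotated 2]) (rule refl)
  moreover have "(\<lambda>t. t * exp ((2 * z - 1) * t)) has_fps_expansion fps_X * fps_exp (2 * z - 1)"
    by (intro has_fps_expansion_mult has_fps_expansion_fps_X has_fps_expansion_exp)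
  ultimately have "F = fps_X * fps_exp (2 * z - 1)"
    by (rule fps_expansion_unique_complex)
  then have "fact N * fps_nth F N = of_nat N * (2 * z - 1) ^ (N - 1)"
    \<comment> \<open>For \<open>N = 0\<close> both sides vanish, whatever the truncated exponent
      \<open>N - 1\<close>; for \<open>N > 0\<close> the factor is
      \<open>fact N / fact (N - 1) = N\<close>.\<close>
    by (cases N) (auto simp: field_simps)
  then show ?thesis
    unfolding F_def fps_nth_egf_mult_of_bool .
qed

lemma sum_euler_poly_parity:
  "(\<Sum>j | j \<le> N \<and> even (N - j). of_nat (N choose j) * (2 ^ j * euler_poly j z))
     = (2 * z - 1) ^ N"
proof -
  define F where "F = Abs_fps (\<lambda>m. 2 ^ m * euler_poly m z / fact m) *
    Abs_fps (\<lambda>m. of_bool (even m) / fact m)"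
  have "(\<lambda>t. 2 * exp (z * (2 * t)) / (exp (2 * t) + 1) * cosh t) has_fps_expansion F"
    unfolding F_def
    by (intro has_fps_expansion_mult cosh_has_fps_expansion
        egf_double_has_fps_expansion[of pi _ "\<lambda>t. 2 * exp (z * t) / (exp t + 1)"]
        euler_poly_sums) auto
  moreover have "\<forall>\<^sub>F t in nhds 0.
      2 * exp (z * (2 * t)) / (exp (2 * t) + 1) * cosh t = exp ((2 * z - 1) * t)"
  proof -
    \<comment> \<open>Continuity and \<open>cosh 0 = 1\<close> keep \<open>cosh\<close> away from 0
      near the origin.\<close>
    have "(cosh \<longlongrightarrow> cosh 0) (nhds (0::complex))"
      by (intro tendsto_intros filterlim_ident)
    then have "\<forall>\<^sub>F t in nhds (0::complex). cosh t \<noteq> 0"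
      by (rule tendsto_imp_eventually_ne) simp
    then show ?thesis
      by eventually_elim (rule euler_gf_double_mult_cosh)
  qed
  ultimately have "(\<lambda>t. exp ((2 * z - 1) * t)) has_fps_expansion F"
    by (rule has_fps_expansion_cong[THEN iffD1, rotated 2]) (rule refl)
  then have "F = fps_exp (2 * z - 1)"
    using has_fps_expansion_exp by (rule fps_expansion_unique_complex)
  then have "fact N * fps_nth F N = (2 * z - 1) ^ N"
    by simp
  then show ?thesis
    unfolding F_def fps_nth_egf_mult_of_bool .
qed

text \<open>Covers both identities: \<open>Suc M = 2 * n\<close> selects the odd \<open>j\<close>,
  \<open>Suc M = 2 * n + 1\<close> the even ones. The Bernoulli sum is evaluated at
  \<open>Suc M\<close>, the Euler sum at \<open>M\<close>.\<close>

lemma sum_bernoulli_poly_eq_sum_euler_poly: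
  "(\<Sum>j | j \<le> Suc M \<and> odd (Suc M - j). 2 ^ j * of_nat (Suc M choose j) * bernoulli_poly j z)
     = (\<Sum>j | j \<le> Suc M \<and> odd (Suc M - j).
          of_nat (Suc j) * 2 ^ j * of_nat (Suc M choose Suc j) * euler_poly j z)"
proof -
  \<comment> \<open>The index \<open>j = Suc M\<close> drops out because
    \<open>Suc M - j = 0\<close> is even; for the others \<open>Suc M - j = Suc (M - j)\<close>
    flips the parity.\<close>
  have idx: "{j. j \<le> Suc M \<and> odd (Suc M - j)} = {j. j \<le> M \<and> even (M - j)}"
    by (auto simp: Suc_diff_le le_Suc_eq)
  have absorb: "of_nat (Suc j) * of_nat (Suc M choose Suc j)
      = (of_nat (Suc M) * of_nat (M choose j) :: complex)" for j
    by (simp only: Suc_times_binomial flip: of_nat_mult)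
  have "(\<Sum>j | j \<le> Suc M \<and> odd (Suc M - j). 2 ^ j * of_nat (Suc M choose j) * bernoulli_poly j z)
      = of_nat (Suc M) * (2 * z - 1) ^ M"
    using sum_bernoulli_poly_parity[of "Suc M" z] by (simp add: mult_ac)
  also have "\<dots> = (\<Sum>j | j \<le> M \<and> even (M - j).
      of_nat (Suc M) * of_nat (M choose j) * 2 ^ j * euler_poly j z)"
    by (simp add: sum_distrib_left mult.assoc flip: sum_euler_poly_parity)
  also have "\<dots> = (\<Sum>j | j \<le> Suc M \<and> odd (Suc M - j).
      of_nat (Suc j) * 2 ^ j * of_nat (Suc M choose Suc j) * euler_poly j z)"
    unfolding idx absorb[symmetric] by (simp only: mult_ac)
  finally show ?thesis .
qed

theorem theorem3p1:
  fixes n :: nat and z :: complex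
  shows "(\<Sum>k=1..n. 2 ^ (2 * k - 1) * of_nat ((2 * n) choose (2 * k - 1)) * bernoulli_poly (2 * k - 1) z)
           = (\<Sum>k=1..n. of_nat k * 2 ^ (2 * k) * of_nat ((2 * n) choose (2 * k)) * euler_poly (2 * k - 1) z)
       \<and> (\<Sum>k=0..n. 2 ^ (2 * k) * of_nat ((2 * n + 1) choose (2 * k)) * bernoulli_poly (2 * k) z)
           = (\<Sum>k=0..n. of_nat (2 * k + 1) * 2 ^ (2 * k) * of_nat ((2 * n + 1) choose (2 * k + 1)) * euler_poly (2 * k) z)"
proof
  show "(\<Sum>k=1..n. 2 ^ (2 * k - 1) * of_nat ((2 * n) choose (2 * k - 1)) * bernoulli_poly (2 * k - 1) z)
      = (\<Sum>k=1..n. of_nat k * 2 ^ (2 * k) * of_nat ((2 * n) choose (2 * k)) * euler_poly (2 * k - 1) z)"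
    (is "?L = ?R")
  \<comment> \<open>For \<open>n = 0\<close> both sums are empty; otherwise \<open>2 * n\<close> is
    a successor, as the common lemma requires.\<close>
  proof (cases n)
    case (Suc m)
    define M where "M = 2 * n - 1"
    have M: "2 * n = Suc M" using Suc by (simp add: M_def)
    have reindex: "(\<Sum>j | j \<le> Suc M \<and> odd (Suc M - j). g j) = (\<Sum>k=1..n. g (2 * k - 1))"
      for g :: "nat \<Rightarrow> complex"
      unfolding M[symmetric]
      by (rule sum.reindex_bij_witness[of _ "\<lambda>k. 2 * k - 1" "\<lambda>j. Suc j div 2"])
        (auto elim!: oddE)
    have "?L = (\<Sum>k=1..n. of_nat (Suc (2 * k - 1)) * 2 ^ (2 * k - 1) *
        of_nat (2 * n choose Suc (2 * k - 1)) * euler_poly (2 * k - 1) z)"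
      using sum_bernoulli_poly_eq_sum_euler_poly[of M z] unfolding reindex M .
    also have "\<dots> = ?R"
    \<comment> \<open>Here \<open>Suc (2 * k - 1) = 2 * k\<close>, and its factor 2 raises
      \<open>2 ^ (2 * k - 1)\<close> to \<open>2 ^ (2 * k)\<close>. This needs
      \<open>k \<ge> 1\<close>, hence the form \<open>Suc i\<close>.\<close>
    proof (intro sum.cong refl)
      fix k assume "k \<in> {1..n}"
      then obtain i where "k = Suc i" by (cases k) auto
      then show "of_nat (Suc (2 * k - 1)) * 2 ^ (2 * k - 1) *
            of_nat (2 * n choose Suc (2 * k - 1)) * euler_poly (2 * k - 1) z
          = of_nat k * 2 ^ (2 * k) * of_nat (2 * n choose (2 * k)) * euler_poly (2 * k - 1) z"
        by (simp add: algebra_simps)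
    qed
    finally show ?thesis .
  qed simp
next
  \<comment> \<open>The selected \<open>j\<close> are even, so \<open>j \<le> 2 * n + 1\<close>
    already means \<open>j \<le> 2 * n\<close>.\<close>
  have reindex: "(\<Sum>j | j \<le> Suc (2 * n) \<and> odd (Suc (2 * n) - j). g j) = (\<Sum>k=0..n. g (2 * k))"
    for g :: "nat \<Rightarrow> complex"
    by (rule sum.reindex_bij_witness[of _ "\<lambda>k. 2 * k" "\<lambda>j. j div 2"])
      (auto simp: Suc_diff_le)
  show "(\<Sum>k=0..n. 2 ^ (2 * k) * of_nat ((2 * n + 1) choose (2 * k)) * bernoulli_poly (2 * k) z)
      = (\<Sum>k=0..n. of_nat (2 * k + 1) * 2 ^ (2 * k) * of_nat ((2 * n + 1) choose (2 * k + 1)) * euler_poly (2 * k) z)"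
    using sum_bernoulli_poly_eq_sum_euler_poly[of "2 * n" z] unfolding reindex by simp
qed

end
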